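(* Let $d\ge1$ be an integer, let $\Omega\subseteq\mathbb{R}^d$ be locally compact and let $\phi$ be a gauge. For a typical function $f\in C(\Omega)$, the set $\{x\in\Omega:\operatorname{lip}_\phi f(x)>0\}$ is microscopic in $\mathbb{R}^d$.
   Context: A gauge is a non-decreasing right-continuous function $\phi\colon[0,\infty)\to[0,\infty)$ with $\phi(0)=0$ and $\phi(r)>0$ for $r>0$. $C(\Omega)$ is the space of continuous real functions on $\Omega$ with the compact-open topology. "For a typical $f$ ... holds" means: there is a comeager set $\mathcal{F}\subseteq C(\Omega)$ such that every $f\in\mathcal{F}$ has the property. Generalized little lip function: $\operatorname{lip}_\phi f(x)=\liminf_{r\to0+}\frac{\operatorname{diam}f(B(x,r))}{\phi(r)}$, where $B(x,r)$ is the closed ball in $\Omega$. A box in $\mathbb{R}^d$ is a cartesian product of $d$ compact intervals in $\mathbb{R}$; $\lambda_d$ is Lebesgue measure. A set $X\subseteq\mathbb{R}^d$ is microscopic if for each $\varepsilon>0$ there is a sequence of boxes $B_1,B_2,\dots$ in $\mathbb{R}^d$ covering $X$ such that $\lambda_d(B_n)\le\varepsilon^n$ for all $n\ge1$. *)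

theory Defs
  imports "HOL-Analysis.Analysis"
begin

(* Functions on [0, oo) are modelled as total functions on the reals whose values at
   negative arguments are irrelevant.  The name avoids the Henstock-Kurzweil gauge. *)
definition gauge_function :: "(real \<Rightarrow> real) \<Rightarrow> bool" where
  "gauge_function \<phi> \<longleftrightarrow>
     \<phi> \<in> {0..} \<rightarrow> {0..} \<and>
     mono_on {0..} \<phi> \<and>
     (\<forall>r\<ge>0. continuous (at_right r) \<phi>) \<and>
     \<phi> 0 = 0 \<and> (\<forall>r>0. \<phi> r > 0)"

(* Extensionality makes the elements correspond one-to-one to the continuous maps from
   \<Omega> to the reals. *)
definition continuous_funcs :: "'a::topological_space set \<Rightarrow> ('a \<Rightarrow> real) set" where
  "continuous_funcs \<Omega> = {f \<in> extensional \<Omega>. continuous_on \<Omega> f}"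

definition compact_open_topology :: "'a::topological_space set \<Rightarrow> ('a \<Rightarrow> real) topology" where
  "compact_open_topology \<Omega> =
     topology_generated_by
       {{f \<in> continuous_funcs \<Omega>. f ` K \<subseteq> U} | K U. compact K \<and> K \<subseteq> \<Omega> \<and> open U}"

lemma topspace_compact_open_topology [simp]:
  "topspace (compact_open_topology \<Omega>) = continuous_funcs \<Omega>"
proof -
  let ?S = "{{f \<in> continuous_funcs \<Omega>. f ` K \<subseteq> U} | K U. compact K \<and> K \<subseteq> \<Omega> \<and> open U}"
  have "continuous_funcs \<Omega> = {f \<in> continuous_funcs \<Omega>. f ` {} \<subseteq> (UNIV::real set)}"
    by simp
  then have "continuous_funcs \<Omega> \<in> ?S"
    by blast
  then have "\<Union>?S = continuous_funcs \<Omega>"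
    by blast
  then show ?thesis
    unfolding compact_open_topology_def topology_generated_by_topspace .
qed

definition nowhere_dense_in :: "'b topology \<Rightarrow> 'b set \<Rightarrow> bool" where
  "nowhere_dense_in X N \<longleftrightarrow> N \<subseteq> topspace X \<and> X interior_of (X closure_of N) = {}"

definition meager_in :: "'b topology \<Rightarrow> 'b set \<Rightarrow> bool" where
  "meager_in X M \<longleftrightarrow> (\<exists>\<N>. countable \<N> \<and> (\<forall>N\<in>\<N>. nowhere_dense_in X N) \<and> M = \<Union>\<N>)"

definition comeager_in :: "'b topology \<Rightarrow> 'b set \<Rightarrow> bool" where
  "comeager_in X F \<longleftrightarrow> F \<subseteq> topspace X \<and> meager_in X (topspace X - F)"

definition typically :: "'a::topological_space set \<Rightarrow> (('a \<Rightarrow> real) \<Rightarrow> bool) \<Rightarrow> bool" where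
  "typically \<Omega> P \<longleftrightarrow> (\<exists>F. comeager_in (compact_open_topology \<Omega>) F \<and> (\<forall>f\<in>F. P f))"

(* Unlike the library's real-valued diameter, this is infinite on unbounded sets;
   the image of a closed ball of \<Omega> may be unbounded since \<Omega> need not be closed. *)
definition ediam :: "'a::metric_space set \<Rightarrow> ennreal" where
  "ediam S = (SUP p\<in>S \<times> S. ennreal (dist (fst p) (snd p)))"

definition little_lip ::
  "(real \<Rightarrow> real) \<Rightarrow> 'a::metric_space set \<Rightarrow> ('a \<Rightarrow> real) \<Rightarrow> 'a \<Rightarrow> ennreal" where
  "little_lip \<phi> \<Omega> f x =
     Liminf (at_right 0) (\<lambda>r. ediam (f ` (\<Omega> \<inter> cball x r)) / ennreal (\<phi> r))"

definition is_box :: "(real ^ 'n) set \<Rightarrow> bool" where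
  "is_box B \<longleftrightarrow> (\<exists>a b. (\<forall>i. a $ i \<le> b $ i) \<and> B = cbox a b)"

definition microscopic :: "(real ^ 'n) set \<Rightarrow> bool" where
  "microscopic X \<longleftrightarrow>
     (\<forall>\<epsilon>>0. \<exists>B :: nat \<Rightarrow> (real ^ 'n) set.
        (\<forall>n\<ge>1. is_box (B n) \<and> measure lborel (B n) \<le> \<epsilon> ^ n) \<and>
        X \<subseteq> (\<Union>n\<in>{1..}. B n))"

end

(* Cover a compact piece of Omega by a fine grid whose walls are thickened so little that
   they form boxes of n-th volume at most eps^n.  By Tietze's theorem any continuous f can be
   perturbed slightly so as to be constant on each of the remaining, well separated cells;
   being nearly constant on these finitely many compact cells is an open condition, however
   small the tolerance eps * phi(r) is.  Intersecting these dense open conditions over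
   eps = 1/k and countably many pieces gives the comeager set: a point with positive lip
   lies in all but finitely many of the box unions, and the lower limit of these unions
   is microscopic. *)
theory Submission
  imports Defs
begin

section \<open>Microscopic sets\<close>

definition box_sequence :: "real \<Rightarrow> (nat \<Rightarrow> (real ^ 'n) set) \<Rightarrow> bool" where
  "box_sequence \<epsilon> B \<longleftrightarrow> (\<forall>n\<ge>1. is_box (B n) \<and> measure lborel (B n) \<le> \<epsilon> ^ n)"

text \<open>A cover for a smaller \<open>\<epsilon>\<close> also serves for a larger one. The bound
  \<open>\<epsilon> < 1\<close> makes powers decrease with the exponent, which the argument for
  countable unions uses.\<close>

lemma microscopicI:
  assumes "\<And>\<epsilon>. 0 < \<epsilon> \<Longrightarrow> \<epsilon> < 1 \<Longrightarrow> \<exists>B. box_sequence \<epsilon> B \<and> X \<subseteq> (\<Union>n\<in>{1..}. B n)"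
  shows "microscopic X"
  unfolding microscopic_def
proof (intro allI impI)
  fix \<epsilon> :: real
  assume "\<epsilon> > 0"
  then obtain B where B: "box_sequence (min \<epsilon> (1/2)) B" "X \<subseteq> (\<Union>n\<in>{1..}. B n)"
    using assms[of "min \<epsilon> (1/2)"] by (auto simp: min_less_iff_disj)
  have "min \<epsilon> (1/2) ^ n \<le> \<epsilon> ^ n" for n
    using \<open>\<epsilon> > 0\<close> by (intro power_mono) auto
  then show "\<exists>B. (\<forall>n\<ge>1. is_box (B n) \<and> measure lborel (B n) \<le> \<epsilon> ^ n) \<and> X \<subseteq> (\<Union>n\<in>{1..}. B n)"
    using B unfolding box_sequence_def by (meson order_trans)
qed

lemma microscopic_subset: "microscopic X \<Longrightarrow> Y \<subseteq> X \<Longrightarrow> microscopic Y"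
  unfolding microscopic_def by (meson subset_trans)

text \<open>With the injectivity below, this identifies the positive integers with the pairs
  \<open>(j, i)\<close>. It serves to interleave countably many covers into a single sequence of
  boxes.\<close>

lemma power2_mult_odd_surj:
  assumes "n \<ge> (1::nat)"
  shows "\<exists>j i. n = 2 ^ j * (2 * i + 1)"
  using assms
proof (induction n rule: less_induct)
  case (less n)
  show ?case
  proof (cases "even n")
    case True
    then obtain m where m: "n = 2 * m" by blast
    with less obtain j i where "m = 2 ^ j * (2 * i + 1)"
      by (metis One_nat_def Suc_leI gr0I less_add_same_cancel1 mult_2 mult_0_right not_one_le_zero)
    with m have "n = 2 ^ Suc j * (2 * i + 1)" by simp
    then show ?thesis by blast
  next
    case False
    then show ?thesis by (metis mult_1 oddE power_0)
  qed
qed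

lemma power2_mult_odd_inj:
  fixes i j i' j' :: nat
  assumes "2 ^ j * (2 * i + 1) = 2 ^ j' * (2 * i' + 1)"
  shows "j = j' \<and> i = i'"
  using assms
proof (induction j arbitrary: j')
  case 0
  then show ?case by (cases j') (auto, presburger)
next
  case (Suc j)
  show ?case
  proof (cases j')
    case 0
    with Suc.prems show ?thesis by (auto, presburger)
  next
    case (Suc k)
    with Suc.prems have "2 ^ j * (2 * i + 1) = 2 ^ k * (2 * i' + 1)" by simp
    from Suc.IH[OF this] Suc show ?thesis by simp
  qed
qed

text \<open>The covers of the pieces are interleaved. Boxes of a later piece get sparser positions
  with larger indices; the parameter \<open>\<epsilon> ^ 2 ^ Suc j\<close> makes them small enough
  for that in advance.\<close>

lemma microscopic_UN_nat:
  assumes "\<And>j::nat. microscopic (X j)"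
  shows "microscopic (\<Union>j. X j)"
proof (rule microscopicI)
  fix \<epsilon> :: real
  assume \<epsilon>: "0 < \<epsilon>" "\<epsilon> < 1"
  have "\<exists>B. box_sequence (\<epsilon> ^ 2 ^ Suc j) B \<and> X j \<subseteq> (\<Union>n\<in>{1..}. B n)" for j
    using assms[of j] \<epsilon> unfolding microscopic_def box_sequence_def by (meson zero_less_power)
  then obtain B where B: "\<And>j. box_sequence (\<epsilon> ^ 2 ^ Suc j) (B j)"
      "\<And>j. X j \<subseteq> (\<Union>n\<in>{1..}. B j n)"
    by metis
  \<comment> \<open>The \<open>(i + 1)\<close>-st box of the cover of \<open>X j\<close> gets the position \<open>2\<^sup>j(2i + 1) \<le> 2\<^sup>j\<^sup>+\<^sup>1(i + 1)\<close>.\<close>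
  define p where "p n = (SOME p. n = 2 ^ fst p * (2 * snd p + (1::nat)))" for n
  have p: "n = 2 ^ fst (p n) * (2 * snd (p n) + 1)" if "n \<ge> 1" for n
    unfolding p_def using power2_mult_odd_surj[OF that] by (intro someI_ex[of "\<lambda>p. n = 2 ^ fst p * (2 * snd p + 1)"]) auto
  define A where "A n = B (fst (p n)) (Suc (snd (p n)))" for n
  have "box_sequence \<epsilon> A"
    unfolding box_sequence_def
  proof (intro allI impI conjI)
    fix n :: nat
    assume n: "n \<ge> 1"
    show "is_box (A n)"
      using B(1)[of "fst (p n)"] unfolding A_def box_sequence_def by simp
    have "measure lborel (A n) \<le> (\<epsilon> ^ 2 ^ Suc (fst (p n))) ^ Suc (snd (p n))"
      using B(1)[of "fst (p n)"] unfolding A_def box_sequence_def by (metis le_add1 plus_1_eq_Suc)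
    also have "\<dots> = \<epsilon> ^ (2 ^ Suc (fst (p n)) * Suc (snd (p n)))"
      by (simp only: power_mult)
    also have "\<dots> \<le> \<epsilon> ^ n"
    proof (rule power_decreasing)
      have "n \<le> 2 ^ fst (p n) * (2 * Suc (snd (p n)))"
        by (subst p[OF n]) (intro mult_left_mono, auto)
      then show "n \<le> 2 ^ Suc (fst (p n)) * Suc (snd (p n))" by (simp add: algebra_simps)
    qed (use \<epsilon> in auto)
    finally show "measure lborel (A n) \<le> \<epsilon> ^ n" .
  qed
  moreover have "(\<Union>j. X j) \<subseteq> (\<Union>n\<in>{1..}. A n)"
  proof
    fix x
    assume "x \<in> (\<Union>j. X j)"
    then obtain j n where "n \<ge> 1" "x \<in> B j n" using B(2) by fastforce
    then obtain i where i: "x \<in> B j (Suc i)" by (cases n) auto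
    define n where "n = 2 ^ j * (2 * i + (1::nat))"
    have "n \<ge> 1" using one_le_power[of "2::nat" j] unfolding n_def by (simp add: Suc_le_eq)
    from p[OF this] have "fst (p n) = j \<and> snd (p n) = i"
      unfolding n_def by (metis power2_mult_odd_inj)
    with i \<open>n \<ge> 1\<close> show "x \<in> (\<Union>n\<in>{1..}. A n)"
      by (auto simp: A_def intro!: bexI[of _ n])
  qed
  ultimately show "\<exists>B. box_sequence \<epsilon> B \<and> (\<Union>j. X j) \<subseteq> (\<Union>n\<in>{1..}. B n)" by blast
qed

lemma is_box_cbox_0: "is_box (cbox 0 0)"
  unfolding is_box_def by (intro exI[of _ 0]) simp

lemma microscopic_empty: "microscopic {}"
proof (rule microscopicI)
  fix \<epsilon> :: real
  assume "0 < \<epsilon>"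
  then have "box_sequence \<epsilon> (\<lambda>n. cbox 0 0)"
    by (simp add: box_sequence_def is_box_cbox_0 zero_power del: cbox_idem)
  then show "\<exists>B. box_sequence \<epsilon> B \<and> {} \<subseteq> (\<Union>n\<in>{1..}. B n)" by blast
qed

lemma microscopic_UN_countable:
  assumes "countable I" "\<And>i. i \<in> I \<Longrightarrow> microscopic (X i)"
  shows "microscopic (\<Union>i\<in>I. X i)"
proof (cases "I = {}")
  case True
  then show ?thesis by (simp add: microscopic_empty)
next
  case False
  then have "(\<Union>i\<in>I. X i) = (\<Union>n. X (from_nat_into I n))"
    using assms(1) by (metis SUP_image image_image range_from_nat_into)
  then show ?thesis
    using microscopic_UN_nat[of "\<lambda>n. X (from_nat_into I n)"] assms(2) False
    by (simp add: from_nat_into)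
qed

text \<open>For given \<open>N\<close> and \<open>\<delta>\<close>, a single
  \<open>k \<ge> N\<close> with \<open>\<epsilon> k < \<delta>\<close> is enough: the inner
  intersection lies in the \<open>k\<close>-th union of boxes. Countable unions of microscopic sets
  then absorb the union over \<open>N\<close>.\<close>

lemma microscopic_liminf:
  assumes B: "\<And>k. box_sequence (\<epsilon> k) (B k)"
    and \<epsilon>: "\<epsilon> \<longlonglongrightarrow> 0" "\<And>k. \<epsilon> k > 0"
  shows "microscopic (\<Union>N. \<Inter>k\<in>{N..}. \<Union>n\<in>{1..}. B k n)"
proof (rule microscopic_UN_nat, rule microscopicI)
  fix N and \<delta> :: real
  assume "\<delta> > 0"
  then have "\<forall>\<^sub>F k in sequentially. \<epsilon> k < \<delta>"
    using \<epsilon>(1) order_tendstoD(2) by blast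
  then obtain k where k: "k \<ge> N" "\<epsilon> k < \<delta>"
    unfolding eventually_sequentially by (meson nle_le)
  have "\<epsilon> k ^ n \<le> \<delta> ^ n" for n
    using k(2) \<epsilon>(2)[of k] by (intro power_mono) auto
  then have "box_sequence \<delta> (B k)"
    using B[of k] unfolding box_sequence_def by (meson order_trans)
  then show "\<exists>A. box_sequence \<delta> A \<and> (\<Inter>k\<in>{N..}. \<Union>n\<in>{1..}. B k n) \<subseteq> (\<Union>n\<in>{1..}. A n)"
    using k(1) by (intro exI[of _ "B k"]) auto
qed

section \<open>Grids\<close>

text \<open>The box is a grid wall, thickened by \<open>s\<close> to both sides and cut off by the
  cube of half-side \<open>M\<close>. For fixed \<open>M\<close> its volume is proportional to
  \<open>s\<close>, hence as small as desired.\<close>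

lemma content_slab:
  fixes i :: "'n::finite"
  assumes "M \<ge> 0" "s \<ge> 0"
  shows "is_box (cbox (\<chi> j. if j = i then t - s else - M) (\<chi> j. if j = i then t + s else M) :: (real^'n) set)"
    and "measure lborel (cbox (\<chi> j. if j = i then t - s else - M) (\<chi> j. if j = i then t + s else M) :: (real^'n) set)
           = 2 * s * (2 * M) ^ (CARD('n) - 1)"
proof -
  let ?a = "(\<chi> j. if j = i then t - s else - M) :: real^'n"
  let ?b = "(\<chi> j. if j = i then t + s else M) :: real^'n"
  have le: "?a $ j \<le> ?b $ j" for j using assms by simp
  then show "is_box (cbox ?a ?b)" unfolding is_box_def by blast
  have "measure lborel (cbox ?a ?b) = (\<Prod>j\<in>UNIV. ?b $ j - ?a $ j)"
    using le by (intro content_cbox_cart) (auto simp: interval_ne_empty_cart)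
  also have "\<dots> = (\<Prod>j\<in>insert i (UNIV - {i}). if j = i then 2 * s else 2 * M)"
    by (intro prod.cong) auto
  also have "\<dots> = 2 * s * (\<Prod>j\<in>UNIV - {i}. if j = i then 2 * s else 2 * M)"
    by (subst prod.insert) auto
  also have "(\<Prod>j\<in>UNIV - {i}. if j = i then 2 * s else 2 * M) = (\<Prod>j\<in>UNIV - {i}. 2 * M)"
    by (intro prod.cong) auto
  also have "\<dots> = (2 * M) ^ (CARD('n) - 1)" by simp
  finally show "measure lborel (cbox ?a ?b) = 2 * s * (2 * M) ^ (CARD('n) - 1)" .
qed

text \<open>The bound on \<open>K\<close> and the mesh \<open>\<delta>\<close> fix the number
  \<open>N\<close> of relevant walls first. Only then is the thickness chosen, so that each wall has
  volume at most \<open>\<epsilon> ^ N\<close> and may take any of the positions \<open>1\<close> to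
  \<open>N\<close>.\<close>

lemma grid_slabs:
  fixes K :: "(real^'n::finite) set"
  assumes "bounded K" "0 < \<epsilon>" "\<epsilon> < 1" "\<delta> > 0"
  obtains s B where "s > 0" "box_sequence \<epsilon> B"
    "\<And>x i m. x \<in> K \<Longrightarrow> x \<notin> (\<Union>n\<in>{1..}. B n) \<Longrightarrow> \<bar>x $ i - of_int m * \<delta>\<bar> > s"
proof -
  obtain M where M: "M > 0" "\<And>x. x \<in> K \<Longrightarrow> norm x \<le> M"
    using assms(1) bounded_pos by blast
  \<comment> \<open>Walls with an index beyond \<open>L\<close> are farther than 1 from
    \<open>K\<close>; as \<open>s \<le> 1\<close> below, they may be ignored.\<close>
  define L where "L = \<lceil>(M + 1) / \<delta>\<rceil>"
  define I where "I = (UNIV :: 'n set) \<times> {- L..L}"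
  define N where "N = card I"
  have "finite I" by (simp add: I_def)
  then obtain g where g: "bij_betw g {0..<N} I"
    unfolding N_def using ex_bij_betw_nat_finite by blast
  define c where "c = 2 * (2 * M) ^ (CARD('n) - 1)"
  have c: "c > 0" using M by (simp add: c_def)
  \<comment> \<open>A slab of half-thickness \<open>s\<close> has volume
    \<open>c * s\<close>.\<close>
  define s where "s = min 1 (\<epsilon> ^ N / c)"
  have s: "s > 0" "s \<le> 1" "c * s \<le> \<epsilon> ^ N"
    using c assms(2) by (auto simp: s_def min_def field_simps)
  define S where "S = (\<lambda>(i::'n, m). cbox (\<chi> j. if j = i then of_int m * \<delta> - s else - M)
       (\<chi> j. if j = i then of_int m * \<delta> + s else M))"
  have S: "is_box (S p)" "measure lborel (S p) = c * s" for p
    using content_slab[where 'n = 'n, of M s] M(1) s(1)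
    by (auto simp: S_def c_def split: prod.split)
  \<comment> \<open>The enumeration \<open>g\<close> starts at 0, but boxes count from 1. Positions
    after \<open>N\<close> are filled with a single point, which has volume 0.\<close>
  define B where "B n = (if n \<le> N then S (g (n - 1)) else cbox 0 0)" for n
  have "box_sequence \<epsilon> B"
    unfolding box_sequence_def
  proof (intro allI impI conjI)
    fix n :: nat
    assume n: "n \<ge> 1"
    show "is_box (B n)"
      using S(1) by (simp add: B_def is_box_cbox_0 del: cbox_idem)
    show "measure lborel (B n) \<le> \<epsilon> ^ n"
    proof (cases "n \<le> N")
      case True
      then have "\<epsilon> ^ N \<le> \<epsilon> ^ n" using assms by (intro power_decreasing) auto
      then show ?thesis using True S(2) s(3) by (simp add: B_def)
    next
      case False
      then show ?thesis using assms by (simp add: B_def content_cbox_cart)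
    qed
  qed
  moreover have "\<bar>x $ i - of_int m * \<delta>\<bar> > s"
    if x: "x \<in> K" "x \<notin> (\<Union>n\<in>{1..}. B n)" for x i m
  proof (rule ccontr)
    assume "\<not> ?thesis"
    then have le: "\<bar>x $ i - of_int m * \<delta>\<bar> \<le> s" by simp
    have xM: "\<bar>x $ j\<bar> \<le> M" for j
      using component_le_norm_cart[of x j] M(2)[OF x(1)] by linarith
    have "\<bar>of_int m * \<delta>\<bar> \<le> M + 1" using le xM[of i] s(2) by linarith
    then have "\<bar>of_int m\<bar> \<le> (M + 1) / \<delta>" using assms(4) by (simp add: abs_mult field_simps)
    then have "\<bar>m\<bar> \<le> L" unfolding L_def by linarith
    then have "(i, m) \<in> I" by (auto simp: I_def)
    then obtain n where n: "n < N" "g n = (i, m)"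
      using g unfolding bij_betw_def by (metis atLeastLessThan_iff imageE)
    have "x \<in> S (i, m)"
      using le xM by (auto simp: S_def mem_box_cart abs_le_iff) (metis add.inverse_inverse minus_le_iff)+
    then have "x \<in> B (Suc n)" using n by (simp add: B_def)
    with x(2) show False by auto
  qed
  ultimately show ?thesis using that s(1) by blast
qed

section \<open>The compact-open topology\<close>

lemma compact_open_uniform_nhd:
  assumes "openin (compact_open_topology \<Omega>) W" "f \<in> W"
  shows "\<exists>\<eta>>0. \<forall>g\<in>continuous_funcs \<Omega>. (\<forall>x\<in>\<Omega>. dist (f x) (g x) < \<eta>) \<longrightarrow> g \<in> W"
proof -
  let ?S = "{{f \<in> continuous_funcs \<Omega>. f ` K \<subseteq> U} | K U. compact K \<and> K \<subseteq> \<Omega> \<and> open U}"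
  have "generate_topology_on ?S W"
    using assms(1) unfolding compact_open_topology_def openin_topology_generated_by_iff .
  then show ?thesis using assms(2)
  proof (induction rule: generate_topology_on.induct)
    case Empty
    then show ?case by simp
  next
    case (Int a b)
    then obtain \<eta> \<eta>' where "\<eta> > 0" "\<eta>' > 0"
        "\<forall>g\<in>continuous_funcs \<Omega>. (\<forall>x\<in>\<Omega>. dist (f x) (g x) < \<eta>) \<longrightarrow> g \<in> a"
        "\<forall>g\<in>continuous_funcs \<Omega>. (\<forall>x\<in>\<Omega>. dist (f x) (g x) < \<eta>') \<longrightarrow> g \<in> b"
      by auto
    then show ?case by (intro exI[of _ "min \<eta> \<eta>'"]) auto
  next
    case (UN \<K>)
    then show ?case by (meson UnionE UnionI)
  next
    case (Basis s)
    then obtain K U where KU: "s = {f \<in> continuous_funcs \<Omega>. f ` K \<subseteq> U}" "compact K" "K \<subseteq> \<Omega>" "open U"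
      by blast
    have "compact (f ` K)"
      using Basis.prems KU continuous_on_subset
      by (intro compact_continuous_image) (auto simp: continuous_funcs_def)
    moreover have "f ` K \<inter> - U = {}" using Basis.prems KU by auto
    ultimately obtain \<eta> where \<eta>: "\<eta> > 0" "\<forall>x\<in>f ` K. \<forall>y\<in>- U. \<eta> \<le> dist x y"
      using separate_compact_closed[of "f ` K" "- U"] KU(4) by (auto simp: closed_Compl)
    show ?case
    proof (intro exI[of _ \<eta>] conjI ballI impI \<eta>(1))
      fix g
      assume g: "g \<in> continuous_funcs \<Omega>" "\<forall>x\<in>\<Omega>. dist (f x) (g x) < \<eta>"
      have "g x \<in> U" if "x \<in> K" for x
        using \<eta>(2) g(2) KU(3) that by (meson ComplI imageI in_mono not_le)
      with g(1) show "g \<in> s" by (auto simp: KU(1))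
    qed
  qed
qed

lemma meager_in_UN:
  assumes "countable I" "\<And>i. i \<in> I \<Longrightarrow> nowhere_dense_in X (N i)"
  shows "meager_in X (\<Union>i\<in>I. N i)"
  unfolding meager_in_def using assms by (intro exI[of _ "N ` I"]) auto

lemma nowhere_dense_in_Diff_dense_open:
  assumes "openin X W" "\<And>T. openin X T \<Longrightarrow> T \<noteq> {} \<Longrightarrow> T \<inter> W \<noteq> {}"
  shows "nowhere_dense_in X (topspace X - W)"
proof -
  have "closedin X (topspace X - W)" using assms(1) by blast
  then have "X closure_of (topspace X - W) = topspace X - W" by (simp add: closure_of_closedin)
  moreover have "X interior_of (topspace X - W) = {}"
    using assms(2)[of "X interior_of (topspace X - W)"] interior_of_subset[of X "topspace X - W"]
    by auto
  ultimately show ?thesis by (simp add: nowhere_dense_in_def)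
qed

section \<open>Functions that are nearly constant off small boxes\<close>

text \<open>On each fibre of \<open>q\<close>, \<open>f\<close> is replaced by its value at one
  chosen point. The correction \<open>h\<close> is bounded by \<open>\<eta>\<close>, and Tietze's
  theorem extends it to \<open>\<Omega>\<close> with the same bound.\<close>

lemma perturb_constant_on_fibres:
  fixes f :: "'a::euclidean_space \<Rightarrow> real"
  assumes f: "continuous_on \<Omega> f" and P: "P \<subseteq> \<Omega>" and fin: "finite (q ` P)"
    and closed: "\<And>v. closed {x \<in> P. q x = v}"
    and osc: "\<And>x y. x \<in> P \<Longrightarrow> y \<in> P \<Longrightarrow> q x = q y \<Longrightarrow> dist (f x) (f y) \<le> \<eta>"
    and "\<eta> \<ge> 0"
  obtains g where "g \<in> continuous_funcs \<Omega>" "\<And>x. x \<in> \<Omega> \<Longrightarrow> dist (f x) (g x) \<le> \<eta>"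
    "\<And>x y. x \<in> P \<Longrightarrow> y \<in> P \<Longrightarrow> q x = q y \<Longrightarrow> g x = g y"
proof -
  define c where "c v = (SOME x. x \<in> P \<and> q x = v)" for v
  have c: "c (q x) \<in> P" "q (c (q x)) = q x" if "x \<in> P" for x
    using someI[of "\<lambda>y. y \<in> P \<and> q y = q x" x] that by (auto simp: c_def)
  define h where "h x = f (c (q x)) - f x" for x
  \<comment> \<open>As a finite union of closed fibres, \<open>P\<close> is closed, and continuity
    of \<open>h\<close> on the single fibres gives continuity on \<open>P\<close>.\<close>
  have P_UN: "P = (\<Union>v\<in>q ` P. {x \<in> P. q x = v})" by auto
  have cont: "continuous_on (\<Union>v\<in>q ` P. {x \<in> P. q x = v}) h"
  proof (rule continuous_on_closed_Union[OF fin closed])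
    fix v
    have "continuous_on {x \<in> P. q x = v} (\<lambda>x. f (c v) - f x)"
      using P by (intro continuous_intros continuous_on_subset[OF f]) auto
    then show "continuous_on {x \<in> P. q x = v} h"
      by (rule continuous_on_eq) (auto simp: h_def)
  qed
  have "continuous_on P h" using cont unfolding P_UN[symmetric] .
  moreover have "closed (\<Union>v\<in>q ` P. {x \<in> P. q x = v})" using fin closed by blast
  then have "closed P" unfolding P_UN[symmetric] .
  then have "closedin (top_of_set \<Omega>) P" using P by (simp add: closed_subset)
  moreover have "norm (h x) \<le> \<eta>" if "x \<in> P" for x
    using osc[of "c (q x)" x] c that by (simp add: h_def dist_real_def)
  ultimately obtain k where k: "continuous_on \<Omega> k" "\<And>x. x \<in> P \<Longrightarrow> k x = h x"
      "\<And>x. x \<in> \<Omega> \<Longrightarrow> norm (k x) \<le> \<eta>"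
    using Tietze[of P h \<Omega> \<eta>] \<open>\<eta> \<ge> 0\<close> by metis
  show ?thesis
  proof (rule that[of "restrict (\<lambda>x. f x + k x) \<Omega>"])
    show "restrict (\<lambda>x. f x + k x) \<Omega> \<in> continuous_funcs \<Omega>"
      unfolding continuous_funcs_def
      using continuous_on_add[OF f k(1)] by (auto cong: continuous_on_cong)
    show "dist (f x) (restrict (\<lambda>x. f x + k x) \<Omega> x) \<le> \<eta>" if "x \<in> \<Omega>" for x
      using k(3)[OF that] that by (simp add: dist_real_def)
    show "restrict (\<lambda>x. f x + k x) \<Omega> x = restrict (\<lambda>x. f x + k x) \<Omega> y"
      if "x \<in> P" "y \<in> P" "q x = q y" for x y
      using that P k(2)[of x] k(2)[of y] by (auto simp: h_def subset_eq)
  qed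
qed

text \<open>The cells are compact so that conditions on them are open in the compact-open topology.
  The bound \<open>r < \<epsilon>\<close> drives the scales to 0 along with
  \<open>\<epsilon>\<close>.\<close>

definition cell_cover ::
  "(real ^ 'n) set \<Rightarrow> (real ^ 'n) set \<Rightarrow> real \<Rightarrow> real \<Rightarrow> (nat \<Rightarrow> (real ^ 'n) set) \<Rightarrow> (real ^ 'n) set set \<Rightarrow> bool"
  where "cell_cover \<Omega> V \<epsilon> r B \<C> \<longleftrightarrow>
    0 < r \<and> r < \<epsilon> \<and> box_sequence \<epsilon> B \<and> finite \<C> \<and> (\<forall>C\<in>\<C>. compact C \<and> C \<subseteq> \<Omega>) \<and>
    (\<forall>x\<in>V - (\<Union>n\<in>{1..}. B n). \<exists>C\<in>\<C>. \<Omega> \<inter> cball x r \<subseteq> C)"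

text \<open>The union runs over all covers: every single cover gives an open set, while for density
  the scale \<open>r\<close> may depend on the function being approximated. Open balls in place of
  exact constancy make the condition open.\<close>

definition nearly_flat ::
  "(real \<Rightarrow> real) \<Rightarrow> (real ^ 'n) set \<Rightarrow> (real ^ 'n) set \<Rightarrow> real \<Rightarrow> (real ^ 'n \<Rightarrow> real) set"
  where "nearly_flat \<phi> \<Omega> V \<epsilon> =
    \<Union> {{f \<in> continuous_funcs \<Omega>. \<forall>C\<in>\<C>. f ` C \<subseteq> ball (a C) (\<epsilon> * \<phi> r)} | r B \<C> a. cell_cover \<Omega> V \<epsilon> r B \<C>}"

lemma openin_nearly_flat: "openin (compact_open_topology \<Omega>) (nearly_flat \<phi> \<Omega> V \<epsilon>)"
  unfolding nearly_flat_def
proof (intro openin_Union)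
  fix T
  assume "T \<in> {{f \<in> continuous_funcs \<Omega>. \<forall>C\<in>\<C>. f ` C \<subseteq> ball (a C) (\<epsilon> * \<phi> r)} | r B \<C> a. cell_cover \<Omega> V \<epsilon> r B \<C>}"
  then obtain r B \<C> a where T: "T = {f \<in> continuous_funcs \<Omega>. \<forall>C\<in>\<C>. f ` C \<subseteq> ball (a C) (\<epsilon> * \<phi> r)}"
    and cov: "cell_cover \<Omega> V \<epsilon> r B \<C>" by blast
  \<comment> \<open>The factor \<open>topspace\<close> matters when \<open>\<C>\<close> is empty,
    since the intersection is then the whole type.\<close>
  have "openin (compact_open_topology \<Omega>)
      (topspace (compact_open_topology \<Omega>) \<inter> (\<Inter>C\<in>\<C>. {f \<in> continuous_funcs \<Omega>. f ` C \<subseteq> ball (a C) (\<epsilon> * \<phi> r)}))"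
  proof (rule openin_Int_Inter)
    show "finite ((\<lambda>C. {f \<in> continuous_funcs \<Omega>. f ` C \<subseteq> ball (a C) (\<epsilon> * \<phi> r)}) ` \<C>)"
      using cov by (simp add: cell_cover_def)
    fix X
    assume "X \<in> (\<lambda>C. {f \<in> continuous_funcs \<Omega>. f ` C \<subseteq> ball (a C) (\<epsilon> * \<phi> r)}) ` \<C>"
    then obtain C where C: "C \<in> \<C>" "X = {f \<in> continuous_funcs \<Omega>. f ` C \<subseteq> ball (a C) (\<epsilon> * \<phi> r)}" by blast
    show "openin (compact_open_topology \<Omega>) X"
      unfolding compact_open_topology_def C(2)
      by (rule topology_generated_by_Basis) (use cov C(1) in \<open>auto simp: cell_cover_def\<close>)
  qed (simp only: openin_topspace)
  also have "topspace (compact_open_topology \<Omega>) \<inter>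
      (\<Inter>C\<in>\<C>. {f \<in> continuous_funcs \<Omega>. f ` C \<subseteq> ball (a C) (\<epsilon> * \<phi> r)}) = T"
    by (auto simp: T)
  finally show "openin (compact_open_topology \<Omega>) T" .
qed

text \<open>The approximating \<open>g\<close> is exactly constant on each cell, so it meets the
  positive tolerance \<open>\<epsilon> * \<phi> r\<close> however small that is. Halving
  \<open>e\<close> leaves room for the balls around points of the piece to stay in the compact set
  \<open>K\<close>.\<close>

lemma nearly_flat_dense:
  fixes \<Omega> :: "(real^'n) set"
  assumes f: "f \<in> continuous_funcs \<Omega>" and e: "e > 0" "compact (\<Omega> \<inter> cball z e)"
    and \<phi>: "gauge_function \<phi>" and \<epsilon>: "0 < \<epsilon>" "\<epsilon> < 1" and "\<eta> > 0"
  obtains g where "g \<in> nearly_flat \<phi> \<Omega> (\<Omega> \<inter> cball z (e / 2)) \<epsilon>" "\<And>x. x \<in> \<Omega> \<Longrightarrow> dist (f x) (g x) \<le> \<eta>"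
proof -
  define K where "K = \<Omega> \<inter> cball z e"
  have K: "compact K" "K \<subseteq> \<Omega>" using e by (auto simp: K_def)
  have contf: "continuous_on \<Omega> f" using f by (simp add: continuous_funcs_def)
  then have "uniformly_continuous_on K f"
    using K compact_uniformly_continuous continuous_on_subset by blast
  then obtain \<rho> where \<rho>: "\<rho> > 0" "\<And>x y. x \<in> K \<Longrightarrow> y \<in> K \<Longrightarrow> dist y x < \<rho> \<Longrightarrow> dist (f y) (f x) < \<eta>"
    using \<open>\<eta> > 0\<close> unfolding uniformly_continuous_on_def by metis
  \<comment> \<open>Points of one grid cube differ by less than \<open>\<delta>\<close> in each
    coordinate, so their distance, bounded by the l1 norm, is less than
    \<open>\<rho>\<close>.\<close>
  define \<delta> where "\<delta> = \<rho> / CARD('n)"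
  have \<delta>: "\<delta> > 0" using \<rho>(1) by (simp add: \<delta>_def)
  obtain s B where s: "s > 0" and B: "box_sequence \<epsilon> B"
    and off: "\<And>x i m. x \<in> K \<Longrightarrow> x \<notin> (\<Union>n\<in>{1..}. B n) \<Longrightarrow> \<bar>x $ i - of_int m * \<delta>\<bar> > s"
    using grid_slabs[of K \<epsilon> \<delta>] compact_imp_bounded[OF K(1)] \<epsilon> \<delta> by metis
  \<comment> \<open>Points of \<open>K\<close> off the boxes are farther than \<open>s\<close> from
    all walls. The threshold \<open>s / 2\<close> leaves a margin of \<open>s / 2\<close> around
    them, and the weak inequality keeps \<open>P\<close> closed.\<close>
  define P where "P = {x \<in> K. \<forall>i (m::int). \<bar>x $ i - of_int m * \<delta>\<bar> \<ge> s / 2}"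
  define q where "q x = (\<chi> i. \<lfloor>x $ i / \<delta>\<rfloor>)" for x :: "real^'n"
  have q: "q x = v \<longleftrightarrow> (\<forall>i. of_int (v $ i) * \<delta> \<le> x $ i \<and> x $ i < of_int (v $ i + 1) * \<delta>)" for x v
    using \<delta> by (simp add: q_def vec_eq_iff floor_eq_iff field_simps)
  have "closed {x \<in> P. q x = v}" for v
  proof -
    \<comment> \<open>On \<open>P\<close> the half-open grid cubes may be replaced by closed ones.\<close>
    have "{x \<in> P. q x = v} =
        K \<inter> (\<Inter>i. \<Inter>m::int. {x. \<bar>x $ i - of_int m * \<delta>\<bar> \<ge> s / 2}) \<inter>
        (\<Inter>i. {x. of_int (v $ i) * \<delta> \<le> x $ i \<and> x $ i \<le> of_int (v $ i + 1) * \<delta>})"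
      (is "?L = ?R")
    proof
      show "?L \<subseteq> ?R" by (auto simp: P_def q less_imp_le)
      show "?R \<subseteq> ?L"
      proof
        fix x
        assume x: "x \<in> ?R"
        then have "x \<in> P" by (auto simp: P_def)
        moreover have "x $ i < of_int (v $ i + 1) * \<delta>" for i
        proof -
          have "x $ i \<le> of_int (v $ i + 1) * \<delta>" "\<bar>x $ i - of_int (v $ i + 1) * \<delta>\<bar> \<ge> s / 2"
            using x by blast+
          then show ?thesis using s by linarith
        qed
        ultimately show "x \<in> ?L" using x by (auto simp: q)
      qed
    qed
    moreover have "closed ?R"
      using compact_imp_closed[OF K(1)]
      by (intro closed_Int closed_INT ballI closed_Collect_conj closed_Collect_le continuous_intros)
    ultimately show ?thesis by simp
  qed
  note closed = this
  have fin: "finite (q ` P)"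
  proof -
    obtain M where M: "\<And>x. x \<in> K \<Longrightarrow> norm x \<le> M"
      using compact_imp_bounded[OF K(1)] bounded_iff by blast
    \<comment> \<open>Finiteness is read off from the coordinate functions: on the bounded set
      \<open>K\<close> each coordinate of \<open>q\<close> takes values in a fixed finite interval
      of integers.\<close>
    have "vec_nth ` q ` P \<subseteq> PiE UNIV (\<lambda>_. {\<lfloor>- M / \<delta>\<rfloor>..\<lfloor>M / \<delta>\<rfloor>})"
    proof (clarsimp simp: PiE_UNIV_domain Pi_iff)
      fix x i
      assume "x \<in> P"
      then have "\<bar>x $ i\<bar> \<le> M" using M[of x] component_le_norm_cart[of x i] by (simp add: P_def)
      then show "\<lfloor>- (M / \<delta>)\<rfloor> \<le> q x $ i \<and> q x $ i \<le> \<lfloor>M / \<delta>\<rfloor>"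
        using \<delta> by (auto simp: q_def intro!: floor_mono) (auto simp: field_simps)
    qed
    then have "finite (vec_nth ` q ` P)"
      by (rule finite_subset) (intro finite_PiE, auto)
    then show ?thesis by (rule finite_imageD) (auto simp: inj_on_def vec_nth_inject)
  qed
  have osc: "dist (f x) (f y) \<le> \<eta>" if xy: "x \<in> P" "y \<in> P" "q x = q y" for x y
  proof -
    have "\<bar>(x - y) $ i\<bar> < \<delta>" for i
    proof -
      have "q x = q x" "q y = q x" using xy by auto
      then have "of_int (q x $ i) * \<delta> \<le> x $ i" "x $ i < of_int (q x $ i + 1) * \<delta>"
          "of_int (q x $ i) * \<delta> \<le> y $ i" "y $ i < of_int (q x $ i + 1) * \<delta>"
        unfolding q by blast+
      then show ?thesis by (simp add: algebra_simps abs_less_iff)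
    qed
    then have "(\<Sum>i\<in>UNIV. \<bar>(x - y) $ i\<bar>) < (\<Sum>i\<in>(UNIV::'n set). \<delta>)"
      by (intro sum_strict_mono) auto
    also have "\<dots> = \<rho>" by (simp add: \<delta>_def)
    finally have "dist x y < \<rho>"
      using norm_le_l1_cart[of "x - y"] by (simp add: dist_norm)
    then show ?thesis using \<rho>(2)[of y x] xy by (simp add: P_def)
  qed
  have P: "P \<subseteq> \<Omega>" "compact P"
  proof -
    show "P \<subseteq> \<Omega>" using K by (auto simp: P_def)
    have "closed (\<Union>v\<in>q ` P. {x \<in> P. q x = v})" using fin closed by blast
    moreover have "(\<Union>v\<in>q ` P. {x \<in> P. q x = v}) = P" by auto
    ultimately have "closed P" by simp
    moreover have "K \<inter> P = P" by (auto simp: P_def)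
    ultimately show "compact P" using compact_Int_closed[OF K(1)] by metis
  qed
  obtain g where g: "g \<in> continuous_funcs \<Omega>" "\<And>x. x \<in> \<Omega> \<Longrightarrow> dist (f x) (g x) \<le> \<eta>"
      "\<And>x y. x \<in> P \<Longrightarrow> y \<in> P \<Longrightarrow> q x = q y \<Longrightarrow> g x = g y"
    by (rule perturb_constant_on_fibres[OF contf P(1) fin closed osc less_imp_le[OF \<open>\<eta> > 0\<close>]])
      (assumption+, rule that)
  \<comment> \<open>The three bounds keep a ball around a point off the boxes away from the walls,
    keep it inside \<open>cball z e\<close>, and give \<open>r < \<epsilon>\<close>
    strictly.\<close>
  define r where "r = min (s / 2) (min (e / 2) (\<epsilon> / 2))"
  have r: "r > 0" "r \<le> s / 2" "r \<le> e / 2" "r < \<epsilon>"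
    using s e \<epsilon> by (auto simp: r_def min_def)
  define \<C> where "\<C> = (\<lambda>v. {x \<in> P. q x = v}) ` q ` P"
  \<comment> \<open>Any point of the cell will do, as \<open>g\<close> is constant there.\<close>
  define a where "a C = g (SOME x. x \<in> C)" for C
  have "cell_cover \<Omega> (\<Omega> \<inter> cball z (e / 2)) \<epsilon> r B \<C>"
    unfolding cell_cover_def
  proof (intro conjI ballI r(1,4) B)
    show "finite \<C>" using fin by (simp add: \<C>_def)
    show "compact C" if "C \<in> \<C>" for C
    proof -
      from that obtain v where C: "C = {x \<in> P. q x = v}" by (auto simp: \<C>_def)
      then have "P \<inter> C = C" by auto
      then show ?thesis using compact_Int_closed[OF P(2) closed[of v]] C by simp
    qed
    show "C \<subseteq> \<Omega>" if "C \<in> \<C>" for C using that P(1) by (auto simp: \<C>_def)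
    fix x
    assume x: "x \<in> \<Omega> \<inter> cball z (e / 2) - (\<Union>n\<in>{1..}. B n)"
    have xK: "x \<in> K" using x e(1) by (auto simp: K_def)
    have far: "\<bar>x $ i - of_int m * \<delta>\<bar> > s" for i m using off[OF xK] x by blast
    have "y \<in> P \<and> q y = q x" if y: "y \<in> \<Omega> \<inter> cball x r" for y
    proof
      have "dist z y \<le> dist z x + dist x y" by (rule dist_triangle)
      then have "y \<in> K" using x y r(3) by (auto simp: K_def)
      have near: "\<bar>x $ i - y $ i\<bar> \<le> s / 2" for i
        using component_le_norm_cart[of "x - y" i] y r(2) by (simp add: dist_norm)
      have "\<bar>y $ i - of_int m * \<delta>\<bar> \<ge> s / 2" for i m using near[of i] far[of i m] by linarith
      then show "y \<in> P" using \<open>y \<in> K\<close> by (auto simp: P_def)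
      have "q x = q x" by simp
      then have "of_int (q x $ i) * \<delta> \<le> x $ i" "x $ i < of_int (q x $ i + 1) * \<delta>" for i
        unfolding q by blast+
      \<comment> \<open>Moving a coordinate by at most \<open>s / 2\<close> cannot cross a wall that
        is more than \<open>s\<close> away.\<close>
      then have "of_int (q x $ i) * \<delta> \<le> y $ i \<and> y $ i < of_int (q x $ i + 1) * \<delta>" for i
        using near[of i] far[of i "q x $ i"] far[of i "q x $ i + 1"] s
        by (smt (verit) field_sum_of_halves)
      then show "q y = q x" by (simp only: q simp_thms)
    qed
    \<comment> \<open>The case \<open>y = x\<close> gives \<open>x \<in> P\<close>, so the fibre
      through \<open>x\<close> is one of the cells.\<close>
    moreover from this[of x] x r(1) have "{y \<in> P. q y = q x} \<in> \<C>" by (auto simp: \<C>_def)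
    ultimately show "\<exists>C\<in>\<C>. \<Omega> \<inter> cball x r \<subseteq> C"
      by (intro bexI[of _ "{y \<in> P. q y = q x}"] subsetI CollectI)
  qed
  moreover have "g ` C \<subseteq> ball (a C) (\<epsilon> * \<phi> r)" if "C \<in> \<C>" for C
  proof
    fix y
    assume "y \<in> g ` C"
    then obtain x where x: "x \<in> C" "y = g x" by blast
    then have "(SOME x. x \<in> C) \<in> C" by (metis someI)
    with x(1) that have "g x = a C" unfolding a_def by (intro g(3)) (auto simp: \<C>_def)
    moreover have "\<epsilon> * \<phi> r > 0" using \<phi> \<epsilon> r by (simp add: gauge_function_def)
    ultimately show "y \<in> ball (a C) (\<epsilon> * \<phi> r)" using x by simp
  qed
  ultimately have "g \<in> nearly_flat \<phi> \<Omega> (\<Omega> \<inter> cball z (e / 2)) \<epsilon>"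
    using g(1) unfolding nearly_flat_def by blast
  with g(2) that show ?thesis by blast
qed

section \<open>From flatness at arbitrarily small scales to a vanishing little lip function\<close>

lemma ediam_le:
  assumes "\<And>x y. x \<in> S \<Longrightarrow> y \<in> S \<Longrightarrow> dist x y \<le> c"
  shows "ediam S \<le> ennreal c"
  unfolding ediam_def using assms by (auto intro!: SUP_least ennreal_leI)

lemma nearly_flatD:
  assumes "f \<in> nearly_flat \<phi> \<Omega> V \<epsilon>"
  obtains r B where "0 < r" "r < \<epsilon>" "box_sequence \<epsilon> B"
    "\<And>x. x \<in> V \<Longrightarrow> x \<notin> (\<Union>n\<in>{1..}. B n) \<Longrightarrow> ediam (f ` (\<Omega> \<inter> cball x r)) \<le> ennreal (2 * \<epsilon> * \<phi> r)"
proof -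
  obtain r B \<C> a where cov: "cell_cover \<Omega> V \<epsilon> r B \<C>" and a: "\<And>C. C \<in> \<C> \<Longrightarrow> f ` C \<subseteq> ball (a C) (\<epsilon> * \<phi> r)"
    using assms unfolding nearly_flat_def by blast
  have "ediam (f ` (\<Omega> \<inter> cball x r)) \<le> ennreal (2 * \<epsilon> * \<phi> r)"
    if x: "x \<in> V" "x \<notin> (\<Union>n\<in>{1..}. B n)" for x
  proof (rule ediam_le)
    fix y y'
    assume y: "y \<in> f ` (\<Omega> \<inter> cball x r)" "y' \<in> f ` (\<Omega> \<inter> cball x r)"
    obtain C where "C \<in> \<C>" "\<Omega> \<inter> cball x r \<subseteq> C" using cov x unfolding cell_cover_def by blast
    with y a have "y \<in> ball (a C) (\<epsilon> * \<phi> r)" "y' \<in> ball (a C) (\<epsilon> * \<phi> r)" by blast+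
    then show "dist y y' \<le> 2 * \<epsilon> * \<phi> r" by (simp add: dist_real_def)
  qed
  then show ?thesis using that cov unfolding cell_cover_def by blast
qed

text \<open>A positive lower limit would keep the quotient above some \<open>c > 0\<close> at all
  small radii, but at the radii \<open>r k\<close> it is at most \<open>2 * \<epsilon> k\<close> for
  arbitrarily large \<open>k\<close>.\<close>

lemma frequently_nearly_flat_imp_little_lip_eq_0:
  assumes \<phi>: "gauge_function \<phi>" and \<epsilon>: "\<epsilon> \<longlonglongrightarrow> 0" "\<And>k. \<epsilon> k > 0"
    and r: "\<And>k. 0 < r k" "\<And>k. r k < \<epsilon> k"
    and freq: "\<And>N. \<exists>k\<ge>N. ediam (f ` (\<Omega> \<inter> cball x (r k))) \<le> ennreal (2 * \<epsilon> k * \<phi> (r k))"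
  shows "little_lip \<phi> \<Omega> f x = 0"
proof (rule ccontr)
  assume "little_lip \<phi> \<Omega> f x \<noteq> 0"
  then have "0 < little_lip \<phi> \<Omega> f x" by (simp add: zero_less_iff_neq_zero)
  then obtain c where c: "0 < c" "c < little_lip \<phi> \<Omega> f x" using dense by blast
  then have "c \<noteq> top" using order_less_le_trans[OF c(2) top_greatest] by blast
  then obtain c' where c': "c = ennreal c'" "c' > 0" using c(1) by (cases c) auto
  have "\<forall>\<^sub>F r in at_right 0. c < ediam (f ` (\<Omega> \<inter> cball x r)) / ennreal (\<phi> r)"
    using c(2) unfolding little_lip_def by (rule less_LiminfD)
  then obtain b where b: "b > 0" "\<And>r. 0 < r \<Longrightarrow> r < b \<Longrightarrow> c < ediam (f ` (\<Omega> \<inter> cball x r)) / ennreal (\<phi> r)"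
    unfolding eventually_at_right_field by auto
  \<comment> \<open>The bound \<open>b\<close> puts \<open>r k\<close> into the range where the
    quotient exceeds \<open>c\<close>; the bound \<open>c' / 2\<close> gives
    \<open>2 * \<epsilon> k < c'\<close>.\<close>
  have "\<forall>\<^sub>F k in sequentially. \<epsilon> k < min b (c' / 2)"
    using order_tendstoD(2)[OF \<epsilon>(1), of "min b (c' / 2)"] b(1) c'(2) by simp
  then obtain N where N: "\<And>k. k \<ge> N \<Longrightarrow> \<epsilon> k < min b (c' / 2)"
    unfolding eventually_sequentially by blast
  obtain k where k: "k \<ge> N" "ediam (f ` (\<Omega> \<inter> cball x (r k))) \<le> ennreal (2 * \<epsilon> k * \<phi> (r k))"
    using freq by blast
  have pos: "\<phi> (r k) > 0" using \<phi> r(1) by (simp add: gauge_function_def)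
  have "ediam (f ` (\<Omega> \<inter> cball x (r k))) / ennreal (\<phi> (r k)) \<le> ennreal (2 * \<epsilon> k * \<phi> (r k)) / ennreal (\<phi> (r k))"
    using k(2) by (rule divide_right_mono_ennreal)
  also have "\<dots> = ennreal (2 * \<epsilon> k)"
    using pos \<epsilon>(2)[of k] by (subst divide_ennreal) auto
  also have "\<dots> \<le> c" using N[OF k(1)] unfolding c'(1) by (intro ennreal_leI) simp
  finally show False using b(2)[of "r k"] r(1)[of k] r(2)[of k] N[OF k(1)] by simp
qed

section \<open>The comeager set, from countably many pieces of \<open>\<Omega>\<close> and countably
  many tolerances\<close>

theorem theorem7p6:
  fixes \<Omega> :: "(real ^ 'n) set" and \<phi> :: "real \<Rightarrow> real"
  assumes "locally compact \<Omega>"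
    and "gauge_function \<phi>"
  shows "typically \<Omega> (\<lambda>f. microscopic {x \<in> \<Omega>. little_lip \<phi> \<Omega> f x > 0})"
proof -
  let ?X = "compact_open_topology \<Omega>"
  have "\<exists>e>0. closed (cball z e \<inter> \<Omega>)" if "z \<in> \<Omega>" for z
    using assms(1) that unfolding locally_compact_Int_cball by blast
  then obtain e where e: "\<And>z. z \<in> \<Omega> \<Longrightarrow> e z > 0" "\<And>z. z \<in> \<Omega> \<Longrightarrow> closed (cball z (e z) \<inter> \<Omega>)"
    by metis
  have cpt: "compact (\<Omega> \<inter> cball z (e z))" if "z \<in> \<Omega>" for z
    using e(2)[OF that] bounded_Int[of "cball z (e z)" \<Omega>] by (simp add: compact_eq_bounded_closed Int_commute)
  let ?U = "\<lambda>z. ball z (e z / 2)"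
  \<comment> \<open>By Lindelof's theorem countably many half-size balls suffice. This leaves
    countably many conditions to intersect and countably many microscopic sets to unite.\<close>
  obtain \<B> where \<B>: "\<B> \<subseteq> ?U ` \<Omega>" "countable \<B>" "\<Union>\<B> = (\<Union>z\<in>\<Omega>. ?U z)"
    by (rule Lindelof[of "?U ` \<Omega>"]) auto
  then have "\<exists>D. countable D \<and> D \<subseteq> \<Omega> \<and> \<B> = ?U ` D"
    using countable_subset_image[of \<B> ?U \<Omega>] by simp
  then obtain D where D: "countable D" "D \<subseteq> \<Omega>" and "\<B> = ?U ` D" by (elim exE conjE)
  with \<B>(3) have UN_D: "(\<Union>z\<in>D. ?U z) = (\<Union>z\<in>\<Omega>. ?U z)" by simp
  define V where "V z = \<Omega> \<inter> cball z (e z / 2)" for z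
  have cover: "\<Omega> \<subseteq> (\<Union>z\<in>D. V z)"
  proof
    fix x
    assume "x \<in> \<Omega>"
    then have "x \<in> (\<Union>z\<in>\<Omega>. ball z (e z / 2))" using e(1) by force
    then show "x \<in> (\<Union>z\<in>D. V z)" using \<open>x \<in> \<Omega>\<close> unfolding UN_D[symmetric] by (force simp: V_def)
  qed
  \<comment> \<open>The two successors keep every \<open>\<epsilon> k\<close> strictly below 1, also
    for \<open>k = 0\<close>.\<close>
  define \<epsilon> where "\<epsilon> k = inverse (real (Suc (Suc k)))" for k
  have \<epsilon>: "0 < \<epsilon> k" "\<epsilon> k < 1" for k by (auto simp: \<epsilon>_def inverse_less_1_iff)
  have lim: "\<epsilon> \<longlonglongrightarrow> 0"
    unfolding \<epsilon>_def using LIMSEQ_Suc[OF LIMSEQ_inverse_real_of_nat] .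
  define W where "W = (\<lambda>(z, k). nearly_flat \<phi> \<Omega> (V z) (\<epsilon> k))"
  \<comment> \<open>This is the intersection of all \<open>W p\<close> within the space, written so
    that its complement is visibly a countable union.\<close>
  define F where "F = topspace ?X - (\<Union>p\<in>D \<times> UNIV. topspace ?X - W p)"
  have nd: "nowhere_dense_in ?X (topspace ?X - W p)" if pD: "p \<in> D \<times> UNIV" for p
  proof (rule nowhere_dense_in_Diff_dense_open)
    obtain z k where p: "p = (z, k)" "z \<in> \<Omega>" using pD D(2) by (cases p) auto
    show "openin ?X (W p)" by (simp add: W_def p openin_nearly_flat)
    fix T
    assume T: "openin ?X T" "T \<noteq> {}"
    then obtain f where f: "f \<in> T" by blast
    obtain \<eta> where \<eta>: "\<eta> > 0" "\<forall>g\<in>continuous_funcs \<Omega>. (\<forall>x\<in>\<Omega>. dist (f x) (g x) < \<eta>) \<longrightarrow> g \<in> T"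
      using compact_open_uniform_nhd[OF T(1) f] by blast
    have "f \<in> continuous_funcs \<Omega>" using openin_subset[OF T(1)] f by auto
    \<comment> \<open>The density lemma gives a weak inequality and the neighbourhood asks for a
      strict one, hence \<open>\<eta> / 2\<close>.\<close>
    then obtain g where g: "g \<in> nearly_flat \<phi> \<Omega> (V z) (\<epsilon> k)" "\<And>x. x \<in> \<Omega> \<Longrightarrow> dist (f x) (g x) \<le> \<eta> / 2"
      unfolding V_def
      using nearly_flat_dense[OF _ e(1)[OF p(2)] cpt[OF p(2)] assms(2) \<epsilon>, of f "\<eta> / 2"] \<eta>(1)
      by (metis half_gt_zero)
    have "g \<in> continuous_funcs \<Omega>" using g(1) by (auto simp: nearly_flat_def)
    moreover have "dist (f x) (g x) < \<eta>" if "x \<in> \<Omega>" for x using g(2)[OF that] \<eta>(1) by linarith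
    ultimately have "g \<in> T" using \<eta>(2) by blast
    with g(1) show "T \<inter> W p \<noteq> {}" by (auto simp: W_def p)
  qed
  have "comeager_in ?X F"
  proof -
    have "topspace ?X - F = (\<Union>p\<in>D \<times> UNIV. topspace ?X - W p)" by (auto simp: F_def)
    moreover have "meager_in ?X (\<Union>p\<in>D \<times> UNIV. topspace ?X - W p)"
      using D(1) nd by (intro meager_in_UN) auto
    ultimately show ?thesis unfolding comeager_in_def by (simp add: F_def)
  qed
  moreover have "microscopic {x \<in> \<Omega>. little_lip \<phi> \<Omega> f x > 0}" if "f \<in> F" for f
  proof -
    have "microscopic {x \<in> V z. little_lip \<phi> \<Omega> f x > 0}" if z: "z \<in> D" for z
    proof -
      have "f \<in> nearly_flat \<phi> \<Omega> (V z) (\<epsilon> k)" for k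
        using \<open>f \<in> F\<close> z by (force simp: F_def W_def)
      then have "\<exists>r B. 0 < r \<and> r < \<epsilon> k \<and> box_sequence (\<epsilon> k) B \<and>
          (\<forall>x\<in>V z - (\<Union>n\<in>{1..}. B n). ediam (f ` (\<Omega> \<inter> cball x r)) \<le> ennreal (2 * \<epsilon> k * \<phi> r))" for k
        by (rule nearly_flatD) blast
      then obtain r B where r: "\<And>k. 0 < r k" "\<And>k. r k < \<epsilon> k" and B: "\<And>k. box_sequence (\<epsilon> k) (B k)"
        and flat: "\<And>k x. x \<in> V z - (\<Union>n\<in>{1..}. B k n) \<Longrightarrow>
          ediam (f ` (\<Omega> \<inter> cball x (r k))) \<le> ennreal (2 * \<epsilon> k * \<phi> (r k))"
        by metis
      \<comment> \<open>A point outside this lower limit escapes the boxes for arbitrarily large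
        \<open>k\<close>, so \<open>f\<close> is nearly flat around it at scales tending to
        0.\<close>
      have "{x \<in> V z. little_lip \<phi> \<Omega> f x > 0} \<subseteq> (\<Union>N. \<Inter>k\<in>{N..}. \<Union>n\<in>{1..}. B k n)"
      proof (rule subsetI, rule ccontr)
        fix x
        assume x: "x \<in> {x \<in> V z. little_lip \<phi> \<Omega> f x > 0}"
          and "x \<notin> (\<Union>N. \<Inter>k\<in>{N..}. \<Union>n\<in>{1..}. B k n)"
        then have out: "\<exists>k\<ge>N. x \<notin> (\<Union>n\<in>{1..}. B k n)" for N
          by (simp only: UN_iff INT_iff atLeast_iff) blast
        have "little_lip \<phi> \<Omega> f x = 0"
          using assms(2) lim \<epsilon>(1) r
        proof (rule frequently_nearly_flat_imp_little_lip_eq_0)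
          fix N
          show "\<exists>k\<ge>N. ediam (f ` (\<Omega> \<inter> cball x (r k))) \<le> ennreal (2 * \<epsilon> k * \<phi> (r k))"
            using x out[of N] flat by (metis (no_types, lifting) DiffI mem_Collect_eq)
        qed
        with x show False by simp
      qed
      then show ?thesis using microscopic_liminf[OF B lim \<epsilon>(1)] microscopic_subset by blast
    qed
    then have "microscopic (\<Union>z\<in>D. {x \<in> V z. little_lip \<phi> \<Omega> f x > 0})"
      by (rule microscopic_UN_countable[OF D(1)])
    then show ?thesis by (rule microscopic_subset) (use cover in blast)
  qed
  ultimately show ?thesis unfolding typically_def by blast
qed

end
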